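(* Let $X$ be a topologically transitive shift of finite type over a finite alphabet $\mathcal A$. Then there exists a primitive random substitution $\vartheta$ (on a possibly different finite alphabet) with associated RS-subshift $X_\vartheta$ such that $X_\vartheta$ is topologically conjugate to $X$.
   Context: A (one-dimensional, two-sided) shift of finite type over a finite alphabet $\mathcal A$ is a subshift of the form $X_{\mathcal F}=\{x\in\mathcal A^{\mathbb Z} : \text{no word of } \mathcal F \text{ is a subword of } x\}$ for some finite set $\mathcal F$ of non-empty finite words over $\mathcal A$. A subshift $X$ is topologically transitive if it is non-empty and for every ordered pair of words $u,v$ in its language there is a word $w$ such that $uwv$ is in its language (irreducibility). Topological conjugacy means a homeomorphism commuting with the shift maps. For a finite alphabet $\mathcal B$, $\mathcal B^+$ is the set of non-empty finite words over $\mathcal B$, and $\mathcal S(\mathcal B^+)$ is the set of all non-empty finite subsets of $\mathcal B^+$. A random substitution on $\mathcal B$ is a map $\vartheta\colon\mathcal B\to\mathcal S(\mathcal B^+)$ (no probabilities are recorded). It extends to words by $\vartheta(a_1\cdots a_m)=\{u_1\cdots u_m : u_i\in\vartheta(a_i)\}$ and to finite non-empty sets of words by $\vartheta(B)=\bigcup_{u\in B}\vartheta(u)$; powers $\vartheta^k$ are defined by iterated composition, with $\vartheta^0(a)=\{a\}$. The language $\mathcal L_\vartheta$ is the set of all words $u$ that are (contiguous) subwords of some element of $\vartheta^k(a)$ for some $k\ge0$ and $a\in\mathcal B$. The RS-subshift is $X_\vartheta=\{w\in\mathcal B^{\mathbb Z} : \text{every finite subword of } w \text{ lies in } \mathcal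 L_\vartheta\}$. The random substitution $\vartheta$ is primitive if there is $k\in\mathbb N$ such that for all $a,b\in\mathcal B$ the letter $a$ occurs in some element of $\vartheta^k(b)$. *)

theory Defs
  imports "HOL-Analysis.Analysis" "HOL-Library.Sublist"
begin

definition full_shift :: "'a set \<Rightarrow> (int \<Rightarrow> 'a) set" where
  "full_shift A = {x. range x \<subseteq> A}"

definition shift_map :: "(int \<Rightarrow> 'a) \<Rightarrow> (int \<Rightarrow> 'a)" where
  "shift_map x = (\<lambda>n. x (n + 1))"

definition subword_of :: "'a list \<Rightarrow> (int \<Rightarrow> 'a) \<Rightarrow> bool" where
  "subword_of w x \<longleftrightarrow> (\<exists>i. \<forall>j<length w. w ! j = x (i + int j))"

definition language :: "(int \<Rightarrow> 'a) set \<Rightarrow> 'a list set" where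
  "language X = {w. \<exists>x\<in>X. subword_of w x}"

definition forbid :: "'a set \<Rightarrow> 'a list set \<Rightarrow> (int \<Rightarrow> 'a) set" where
  "forbid A F = {x \<in> full_shift A. \<forall>w\<in>F. \<not> subword_of w x}"

definition shift_of_finite_type :: "'a set \<Rightarrow> (int \<Rightarrow> 'a) set \<Rightarrow> bool" where
  "shift_of_finite_type A X \<longleftrightarrow> (\<exists>F. finite F \<and> F \<subseteq> lists A - {[]} \<and> X = forbid A F)"

definition topologically_transitive :: "(int \<Rightarrow> 'a) set \<Rightarrow> bool" where
  "topologically_transitive X \<longleftrightarrow>
     X \<noteq> {} \<and> (\<forall>u\<in>language X. \<forall>v\<in>language X. \<exists>w. u @ w @ v \<in> language X)"

definition shift_topology :: "'a set \<Rightarrow> (int \<Rightarrow> 'a) set \<Rightarrow> (int \<Rightarrow> 'a) topology" where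
  "shift_topology A X = subtopology (product_topology (\<lambda>_. discrete_topology A) UNIV) X"

definition topologically_conjugate ::
    "'a set \<Rightarrow> (int \<Rightarrow> 'a) set \<Rightarrow> 'b set \<Rightarrow> (int \<Rightarrow> 'b) set \<Rightarrow> bool" where
  "topologically_conjugate A X B Y \<longleftrightarrow>
     (\<exists>h. homeomorphic_map (shift_topology A X) (shift_topology B Y) h \<and>
          (\<forall>x\<in>X. h (shift_map x) = shift_map (h x)))"

text \<open>A random substitution is a function on the whole type; only its values on the
  alphabet \<open>B\<close> matter.\<close>

definition random_substitution :: "'b set \<Rightarrow> ('b \<Rightarrow> 'b list set) \<Rightarrow> bool" where
  "random_substitution B \<theta> \<longleftrightarrow>
     finite B \<and> B \<noteq> {} \<and>
     (\<forall>b\<in>B. finite (\<theta> b) \<and> \<theta> b \<noteq> {} \<and> \<theta> b \<subseteq> lists B - {[]})"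

definition subst_word :: "('b \<Rightarrow> 'b list set) \<Rightarrow> 'b list \<Rightarrow> 'b list set" where
  "subst_word \<theta> w = {concat us | us. list_all2 (\<lambda>u a. u \<in> \<theta> a) us w}"

definition subst_set :: "('b \<Rightarrow> 'b list set) \<Rightarrow> 'b list set \<Rightarrow> 'b list set" where
  "subst_set \<theta> W = (\<Union>w\<in>W. subst_word \<theta> w)"

definition subst_power :: "('b \<Rightarrow> 'b list set) \<Rightarrow> nat \<Rightarrow> 'b \<Rightarrow> 'b list set" where
  "subst_power \<theta> k a = (subst_set \<theta> ^^ k) {[a]}"

definition subst_language :: "'b set \<Rightarrow> ('b \<Rightarrow> 'b list set) \<Rightarrow> 'b list set" where
  "subst_language B \<theta> = {u. \<exists>k. \<exists>a\<in>B. \<exists>v\<in>subst_power \<theta> k a. sublist u v}"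

definition RS_subshift :: "'b set \<Rightarrow> ('b \<Rightarrow> 'b list set) \<Rightarrow> (int \<Rightarrow> 'b) set" where
  "RS_subshift B \<theta> =
     {x \<in> full_shift B. \<forall>u. subword_of u x \<longrightarrow> u \<in> subst_language B \<theta>}"

definition primitive_subst :: "'b set \<Rightarrow> ('b \<Rightarrow> 'b list set) \<Rightarrow> bool" where
  "primitive_subst B \<theta> \<longleftrightarrow>
     (\<exists>k>0. \<forall>a\<in>B. \<forall>b\<in>B. \<exists>v\<in>subst_power \<theta> k b. a \<in> set v)"

end

theory Submission imports Defs
begin

text \<open>
  Recoding by overlapping blocks turns a shift of finite type into a vertex shift: the bi-infinite
  walks in a finite directed graph. Topological transitivity of the shift makes the graph strongly
  connected.

  A strongly connected vertex shift is the subshift of the random substitution that replaces a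
  letter \<open>b\<close> by any closed walk from \<open>b\<close> to \<open>b\<close> of length at most \<open>N\<close>. Such a replacement keeps the
  first and the last letter, so it maps walks to walks, and only walks are generated
  (\<open>subst_word_walk\<close>). Conversely, a long walk visits some vertex twice within a bounded time;
  contracting the piece between these visits to one letter yields a shorter walk of which the
  given walk is an image. Iterating this leads to a short walk, which can be completed to a closed
  walk and thus lies inside the image of a single letter, provided that \<open>N\<close> is large enough
  (\<open>walk_in_subst_language\<close>). Hence the generated language consists exactly of the walks. The
  substitution is primitive in one step, since a closed walk at \<open>b\<close> can pass through any vertex.
\<close>

section \<open>Walks and vertex shifts\<close>

definition walk :: "'b set \<Rightarrow> ('b \<Rightarrow> 'b \<Rightarrow> bool) \<Rightarrow> 'b list \<Rightarrow> bool" where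
  "walk B R w \<longleftrightarrow> set w \<subseteq> B \<and> successively R w"

definition walk_between ::
    "'b set \<Rightarrow> ('b \<Rightarrow> 'b \<Rightarrow> bool) \<Rightarrow> 'b \<Rightarrow> 'b \<Rightarrow> 'b list \<Rightarrow> bool" where
  "walk_between B R a b w \<longleftrightarrow> walk B R w \<and> w \<noteq> [] \<and> hd w = a \<and> last w = b"

definition strongly_connected :: "'b set \<Rightarrow> ('b \<Rightarrow> 'b \<Rightarrow> bool) \<Rightarrow> bool" where
  "strongly_connected B R \<longleftrightarrow> (\<forall>a\<in>B. \<forall>b\<in>B. \<exists>w. walk_between B R a b w)"

definition vertex_shift :: "'b set \<Rightarrow> ('b \<Rightarrow> 'b \<Rightarrow> bool) \<Rightarrow> (int \<Rightarrow> 'b) set" where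
  "vertex_shift B R = {x. \<forall>n. x n \<in> B \<and> R (x n) (x (n + 1))}"

definition loop_subst :: "nat \<Rightarrow> 'b set \<Rightarrow> ('b \<Rightarrow> 'b \<Rightarrow> bool) \<Rightarrow> 'b \<Rightarrow> 'b list set" where
  "loop_subst N B R b = {w. walk_between B R b b w \<and> length w \<le> N}"

lemma walk_append_iff:
  "walk B R (u @ v) \<longleftrightarrow>
     walk B R u \<and> walk B R v \<and> (u = [] \<or> v = [] \<or> R (last u) (hd v))"
  by (auto simp: walk_def successively_append_iff)

lemma walk_sublist: "walk B R v \<Longrightarrow> sublist u v \<Longrightarrow> walk B R u"
  by (auto simp: sublist_def walk_append_iff)

lemma walk_between_join:
  assumes u: "walk_between B R a b u" and v: "walk_between B R b c v"
  shows "walk_between B R a c (u @ tl v)"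
proof (cases v)
  case Nil
  then show ?thesis using v by (simp add: walk_between_def)
next
  case (Cons b' v')
  then show ?thesis using u v
    by (cases v') (auto simp: walk_between_def walk_def successively_append_iff successively_Cons)
qed

section \<open>Images of words under a random substitution\<close>

lemma subst_word_append:
  assumes "u \<in> subst_word \<theta> v" "u' \<in> subst_word \<theta> v'"
  shows "u @ u' \<in> subst_word \<theta> (v @ v')"
proof -
  obtain us us' where "u = concat us" "list_all2 (\<lambda>u a. u \<in> \<theta> a) us v"
      "u' = concat us'" "list_all2 (\<lambda>u a. u \<in> \<theta> a) us' v'"
    using assms by (auto simp: subst_word_def)
  then show ?thesis
    by (auto simp: subst_word_def intro!: exI[of _ "us @ us'"] list_all2_appendI)
qed

lemma subst_word_singleton: "u \<in> \<theta> a \<Longrightarrow> u \<in> subst_word \<theta> [a]"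
  unfolding subst_word_def by (auto intro!: exI[of _ "[u]"])

lemma subst_word_refl:
  assumes "\<And>a. a \<in> set v \<Longrightarrow> [a] \<in> \<theta> a"
  shows "v \<in> subst_word \<theta> v"
  using assms
proof (induction v)
  case Nil
  then show ?case by (auto simp: subst_word_def)
next
  case (Cons a v)
  have "[a] @ v \<in> subst_word \<theta> ([a] @ v)"
    by (intro subst_word_append subst_word_singleton Cons) (use Cons.prems in auto)
  then show ?case by simp
qed

lemma subst_power_1: "u \<in> \<theta> a \<Longrightarrow> u \<in> subst_power \<theta> 1 a"
  by (auto simp: subst_power_def subst_set_def subst_word_singleton)

lemma subst_power_Suc:
  "v \<in> subst_power \<theta> k a \<Longrightarrow> u \<in> subst_word \<theta> v \<Longrightarrow> u \<in> subst_power \<theta> (Suc k) a"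
  by (auto simp: subst_power_def subst_set_def)

section \<open>The language generated by closed walks\<close>

lemma loop_subst_refl: "b \<in> B \<Longrightarrow> 1 \<le> N \<Longrightarrow> [b] \<in> loop_subst N B R b"
  by (simp add: loop_subst_def walk_between_def walk_def)

text \<open>Consecutive images fit together because the image of a letter starts and ends with that
  letter; the statement about the end points is what makes the induction work.\<close>

lemma subst_word_walk:
  assumes "u \<in> subst_word (loop_subst N B R) w" "walk_between B R a b w"
  shows "walk_between B R a b u"
proof -
  obtain us where "u = concat us" "list_all2 (\<lambda>u a. u \<in> loop_subst N B R a) us w"
    using assms(1) by (auto simp: subst_word_def)
  moreover have "list_all2 (\<lambda>u a. u \<in> loop_subst N B R a) us w \<Longrightarrow> walk_between B R a b w
      \<Longrightarrow> walk_between B R a b (concat us)"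
  proof (induction us w arbitrary: a rule: list_all2_induct)
    case Nil
    then show ?case by (simp add: walk_between_def)
  next
    case (Cons v vs c w)
    have v: "walk_between B R c c v" and "c = a"
      using Cons by (auto simp: loop_subst_def walk_between_def)
    show ?case
    proof (cases "w = []")
      case True
      then show ?thesis using Cons v by (auto simp: walk_between_def)
    next
      case False
      then have "walk_between B R (hd w) b w" and R: "R c (hd w)"
        using Cons.prems by (auto simp: walk_between_def walk_def successively_Cons)
      then have "walk_between B R (hd w) b (concat vs)"
        using Cons.IH by blast
      then show ?thesis
        using v R \<open>c = a\<close> by (auto simp: walk_between_def walk_append_iff)
    qed
  qed
  ultimately show ?thesis using assms(2) by blast
qed

lemma subst_power_walk:
  assumes "a \<in> B"
  shows "v \<in> subst_power (loop_subst N B R) k a \<Longrightarrow> walk_between B R a a v"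
proof (induction k arbitrary: v)
  case 0
  then show ?case using assms by (simp add: subst_power_def walk_between_def walk_def)
next
  case (Suc k)
  then obtain w where "w \<in> subst_power (loop_subst N B R) k a"
      "v \<in> subst_word (loop_subst N B R) w"
    by (auto simp: subst_power_def subst_set_def)
  then show ?case by (intro subst_word_walk[of v N B R w] Suc.IH)
qed

lemma subst_language_walk:
  assumes "u \<in> subst_language B (loop_subst N B R)"
  shows "walk B R u"
proof -
  obtain k a v where "a \<in> B" "v \<in> subst_power (loop_subst N B R) k a" "sublist u v"
    using assms by (auto simp: subst_language_def)
  then show ?thesis
    using subst_power_walk[of a B v N R k] walk_sublist[of B R v u] by (simp add: walk_between_def)
qed

text \<open>A walk with more letters than the graph has vertices repeats a vertex among its first
  \<open>card B + 1\<close> entries. Looking only at these entries bounds the length of the contracted piece,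
  so that it is an admissible image of the repeated letter.\<close>

lemma walk_contract:
  assumes "finite B" and w: "walk B R w" and long: "card B < length w" and N: "card B < N"
  obtains w' where "walk B R w'" "w' \<noteq> []" "length w' < length w"
    "w \<in> subst_word (loop_subst N B R) w'"
proof -
  define p where "p = take (Suc (card B)) w"
  have p: "length p = Suc (card B)" "set p \<subseteq> B" and w_eq: "w = p @ drop (Suc (card B)) w"
    using long w by (auto simp: p_def walk_def dest: in_set_takeD)
  have "card (set p) \<le> card B" using p assms(1) by (simp add: card_mono)
  then have "\<not> distinct p" using p distinct_card[of p] by auto
  then obtain xs y ys zs where dec: "p = xs @ [y] @ ys @ [y] @ zs"
    using not_distinct_decomp by blast
  define r where "r = zs @ drop (Suc (card B)) w"
  have w_dec: "w = xs @ ([y] @ ys @ [y]) @ r"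
    using w_eq dec by (simp add: r_def)
  let ?\<theta> = "loop_subst N B R"
  have refl: "v \<in> subst_word ?\<theta> v" if "set v \<subseteq> B" for v
    using that N by (intro subst_word_refl loop_subst_refl) auto
  have "walk B R ([y] @ ys @ [y])" using w by (simp only: w_dec walk_append_iff)
  moreover have "length ([y] @ ys @ [y]) \<le> N" using p dec N by simp
  ultimately have "[y] @ ys @ [y] \<in> ?\<theta> y" by (simp add: loop_subst_def walk_between_def)
  then have "w \<in> subst_word ?\<theta> (xs @ [y] @ r)"
    unfolding w_dec using w
    by (intro subst_word_append subst_word_singleton refl) (auto simp: w_dec walk_def)
  moreover have "walk B R (xs @ [y] @ r)"
    using w by (auto simp: w_dec walk_def successively_append_iff successively_Cons)
  ultimately show ?thesis using that[of "xs @ [y] @ r"] by (simp add: w_dec)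
qed

text \<open>The length bound on the images must exceed \<open>card B + K\<close>, where any two vertices are joined by
  a walk with at most \<open>K\<close> entries, so that a walk with at most \<open>card B\<close> entries can be closed up.\<close>

lemma walk_in_subst_language:
  assumes fin: "finite B" and "B \<noteq> {}"
    and conn: "\<And>a b. a \<in> B \<Longrightarrow> b \<in> B \<Longrightarrow> \<exists>w. walk_between B R a b w \<and> length w \<le> K"
    and N: "card B + K < N"
  shows "walk B R w \<Longrightarrow> w \<in> subst_language B (loop_subst N B R)"
proof (induction w rule: length_induct)
  case (1 w)
  let ?\<theta> = "loop_subst N B R"
  consider "w = []" | "w \<noteq> []" "length w \<le> card B" | "card B < length w" by linarith
  then show ?case
  proof cases
    case 1
    obtain b where "b \<in> B" using assms(2) by blast
    moreover have "[b] \<in> subst_power ?\<theta> 0 b" by (simp add: subst_power_def)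
    ultimately show ?thesis using \<open>w = []\<close> by (force simp: subst_language_def)
  next
    case 2
    then have ends: "hd w \<in> B" "last w \<in> B"
      using "1.prems" by (auto simp: walk_def)
    then obtain p where p: "walk_between B R (last w) (hd w) p" "length p \<le> K"
      using conn by blast
    have "walk_between B R (hd w) (last w) w" using 2 "1.prems" by (simp add: walk_between_def)
    then have "walk_between B R (hd w) (hd w) (w @ tl p)"
      using p(1) by (rule walk_between_join)
    moreover have "length (w @ tl p) \<le> N" using 2 p(2) N by simp
    ultimately have "w @ tl p \<in> subst_power ?\<theta> 1 (hd w)"
      by (intro subst_power_1) (simp add: loop_subst_def)
    moreover have "sublist w (w @ tl p)" by simp
    ultimately show ?thesis unfolding subst_language_def using ends(1) by blast
  next
    case 3
    obtain w' where w': "walk B R w'" "length w' < length w" "w \<in> subst_word ?\<theta> w'"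
      using walk_contract[OF fin "1.prems" 3, of N] N by auto
    then have "w' \<in> subst_language B ?\<theta>" using "1.IH" by blast
    then obtain k a ps ss where a: "a \<in> B" and v: "ps @ w' @ ss \<in> subst_power ?\<theta> k a"
      by (auto simp: subst_language_def sublist_def)
    have "set (ps @ w' @ ss) \<subseteq> B"
      using subst_power_walk[OF a v] by (simp add: walk_between_def walk_def)
    then have "ps @ w @ ss \<in> subst_word ?\<theta> (ps @ w' @ ss)"
      using w' N by (intro subst_word_append subst_word_refl loop_subst_refl) auto
    then have "ps @ w @ ss \<in> subst_power ?\<theta> (Suc k) a" by (rule subst_power_Suc[OF v])
    moreover have "sublist w (ps @ w @ ss)" by simp
    ultimately show ?thesis unfolding subst_language_def using a by blast
  qed
qed

section \<open>Strongly connected vertex shifts are RS-subshifts\<close>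

lemma vertex_shift_iff_walks:
  "x \<in> vertex_shift B R \<longleftrightarrow> (\<forall>u. subword_of u x \<longrightarrow> walk B R u)"
proof
  assume x: "x \<in> vertex_shift B R"
  show "\<forall>u. subword_of u x \<longrightarrow> walk B R u"
  proof (intro allI impI)
    fix u assume "subword_of u x"
    then obtain i where i: "\<And>j. j < length u \<Longrightarrow> u ! j = x (i + int j)"
      by (auto simp: subword_of_def)
    have "R (u ! j) (u ! Suc j)" if "Suc j < length u" for j
    proof -
      have "R (x (i + int j)) (x (i + int j + 1))" using x by (auto simp: vertex_shift_def)
      then show ?thesis using i[of j] i[of "Suc j"] that by (simp add: ac_simps)
    qed
    moreover have "set u \<subseteq> B" using x i by (auto simp: vertex_shift_def in_set_conv_nth)
    ultimately show "walk B R u" by (simp add: walk_def successively_conv_nth)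
  qed
next
  assume walks: "\<forall>u. subword_of u x \<longrightarrow> walk B R u"
  have "walk B R [x n, x (n + 1)]" for n
    by (rule walks[rule_format]) (auto simp: subword_of_def less_Suc_eq intro!: exI[of _ n])
  then show "x \<in> vertex_shift B R" by (simp add: vertex_shift_def walk_def)
qed

theorem vertex_shift_is_RS_subshift:
  assumes fin: "finite B" and ne: "B \<noteq> {}" and sc: "strongly_connected B R"
  shows "\<exists>\<theta>. random_substitution B \<theta> \<and> primitive_subst B \<theta> \<and>
           RS_subshift B \<theta> = vertex_shift B R"
proof -
  obtain p where p: "\<And>a b. a \<in> B \<Longrightarrow> b \<in> B \<Longrightarrow> walk_between B R a b (p a b)"
    using sc unfolding strongly_connected_def by metis
  define K where "K = Max ((\<lambda>(a, b). length (p a b)) ` (B \<times> B))"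
  have K: "length (p a b) \<le> K" if "a \<in> B" "b \<in> B" for a b
    unfolding K_def using that fin by (intro Max_ge) (auto simp: image_iff)
  \<comment> \<open>The summand \<open>2 * K\<close> leaves room for a closed walk through a prescribed vertex.\<close>
  define N where "N = Suc (card B + 2 * K)"
  let ?\<theta> = "loop_subst N B R"
  have rs: "random_substitution B ?\<theta>"
    unfolding random_substitution_def
  proof (intro conjI ballI fin ne)
    fix b assume "b \<in> B"
    then show "?\<theta> b \<noteq> {}" using loop_subst_refl[of b B N R] by (auto simp: N_def)
    show "finite (?\<theta> b)"
      by (rule finite_subset[OF _ finite_lists_length_le[OF fin, of N]])
        (auto simp: loop_subst_def walk_between_def walk_def)
    show "?\<theta> b \<subseteq> lists B - {[]}"
      by (auto simp: loop_subst_def walk_between_def walk_def)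
  qed
  have prim: "primitive_subst B ?\<theta>"
    unfolding primitive_subst_def
  proof (intro exI[of _ 1] conjI ballI)
    fix a b assume ab: "a \<in> B" "b \<in> B"
    have "walk_between B R b b (p b a @ tl (p a b))"
      using p ab by (blast intro: walk_between_join)
    moreover have "length (p b a @ tl (p a b)) \<le> N"
      using K[of b a] K[of a b] ab by (simp add: N_def)
    moreover have "a \<in> set (p b a @ tl (p a b))"
      using p[of b a] ab last_in_set by (fastforce simp: walk_between_def)
    ultimately show "\<exists>v\<in>subst_power ?\<theta> 1 b. a \<in> set v"
      by (intro bexI[of _ "p b a @ tl (p a b)"] subst_power_1) (auto simp: loop_subst_def)
  qed simp
  have K_less: "card B + K < N" by (simp add: N_def)
  have "walk B R u \<Longrightarrow> u \<in> subst_language B ?\<theta>" for u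
    by (rule walk_in_subst_language[OF fin ne _ K_less]) (use p K in blast)+
  then have lang: "u \<in> subst_language B ?\<theta> \<longleftrightarrow> walk B R u" for u
    using subst_language_walk[of u B N R] by blast
  have "vertex_shift B R \<subseteq> full_shift B" by (auto simp: vertex_shift_def full_shift_def)
  then have "RS_subshift B ?\<theta> = vertex_shift B R"
    using vertex_shift_iff_walks[of _ B R] by (auto simp: RS_subshift_def lang)
  with rs prim show ?thesis by blast
qed

section \<open>Windows of bi-infinite sequences\<close>

definition window :: "(int \<Rightarrow> 'a) \<Rightarrow> int \<Rightarrow> nat \<Rightarrow> 'a list" where
  "window x i m = map (\<lambda>j. x (i + int j)) [0..<m]"

lemma length_window [simp]: "length (window x i m) = m"
  by (simp add: window_def)

lemma nth_window [simp]: "j < m \<Longrightarrow> window x i m ! j = x (i + int j)"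
  by (simp add: window_def)

lemma hd_window: "0 < m \<Longrightarrow> hd (window x i m) = x i"
  by (subst hd_conv_nth) (auto simp flip: length_greater_0_conv)

lemma window_overlap: "tl (window x i m) = butlast (window x (i + 1) m)"
  by (rule nth_equalityI) (auto simp: nth_tl nth_butlast ac_simps)

lemma subword_of_iff_window: "subword_of w x \<longleftrightarrow> (\<exists>i. w = window x i (length w))"
  by (auto simp: subword_of_def list_eq_iff_nth_eq)

lemma window_in_language: "x \<in> X \<Longrightarrow> window x i m \<in> language X"
  by (auto simp: language_def subword_of_iff_window)

lemma shift_of_finite_type_subset: "shift_of_finite_type A X \<Longrightarrow> X \<subseteq> full_shift A"
  by (auto simp: shift_of_finite_type_def forbid_def)

text \<open>Once \<open>m\<close> is at least the length of every forbidden word, the admissible words of length \<open>m\<close>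
  decide membership in a shift of finite type.\<close>

lemma shift_of_finite_type_windows:
  assumes "shift_of_finite_type A X"
  obtains m where "0 < m" "\<And>x. (\<And>i. window x i m \<in> language X) \<Longrightarrow> x \<in> X"
proof -
  obtain F where F: "finite F" "X = forbid A F"
    using assms by (auto simp: shift_of_finite_type_def)
  define m where "m = Suc (Max (insert 0 (length ` F)))"
  have long: "length w < m" if "w \<in> F" for w
    using F(1) that by (auto simp: m_def less_Suc_eq_le)
  have "x \<in> X" if win: "\<And>i. window x i m \<in> language X" for x
  proof -
    have *: "\<exists>z\<in>X. \<exists>k. \<forall>j<m. x (i + int j) = z (k + int j)" for i
      using win[of i] by (force simp: language_def subword_of_def)
    have "x i \<in> A" for i
    proof -
      obtain z k where "z \<in> X" "x (i + int 0) = z (k + int 0)"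
        using *[of i] by (force simp: m_def)
      then show ?thesis by (auto simp: F(2) forbid_def full_shift_def)
    qed
    moreover have "\<not> subword_of w x" if w: "w \<in> F" for w
    proof
      assume "subword_of w x"
      then obtain i where i: "\<And>j. j < length w \<Longrightarrow> w ! j = x (i + int j)"
        by (auto simp: subword_of_def)
      obtain z k where z: "z \<in> X" "\<And>j. j < m \<Longrightarrow> x (i + int j) = z (k + int j)"
        using *[of i] by blast
      have "subword_of w z"
        unfolding subword_of_def using i z(2) long[OF w] by (intro exI[of _ k]) auto
      then show False using z(1) w by (auto simp: F(2) forbid_def)
    qed
    ultimately show ?thesis by (auto simp: F(2) forbid_def full_shift_def)
  qed
  then show ?thesis using that[of m] by (simp add: m_def)
qed

section \<open>Sliding block maps are continuous\<close>

lemma topspace_shift_topology: "X \<subseteq> full_shift A \<Longrightarrow> topspace (shift_topology A X) = X"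
  by (auto simp: shift_topology_def full_shift_def)

text \<open>A finite window constrains finitely many coordinates, each by an open condition. This makes
  functions of a window locally constant, hence continuous.\<close>

lemma openin_cylinder:
  assumes "X \<subseteq> full_shift A" "x \<in> X"
  shows "openin (shift_topology A X) {y \<in> X. window y n m = window x n m}"
proof -
  define I where "I = {n..<n + int m}"
  define C where "C = (\<Pi>\<^sub>E i\<in>UNIV. if i \<in> I then {x i} else A)"
  have xA: "x i \<in> A" for i using assms by (auto simp: full_shift_def)
  have I: "i \<in> I \<longleftrightarrow> (\<exists>j<m. i = n + int j)" for i
    unfolding I_def by (auto intro: exI[of _ "nat (i - n)"])
  have "finite {i \<in> UNIV. (if i \<in> I then {x i} else A) \<noteq> topspace (discrete_topology A)}"
    by (rule finite_subset[of _ I]) (auto simp: I_def)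
  then have "openin (product_topology (\<lambda>_. discrete_topology A) UNIV) C"
    unfolding C_def openin_PiE_gen using xA by auto
  moreover have "{y \<in> X. window y n m = window x n m} = C \<inter> X"
  proof -
    have "window y n m = window x n m \<longleftrightarrow> (\<forall>i\<in>I. y i = x i)" for y
      by (auto simp: list_eq_iff_nth_eq I)
    then show ?thesis
      using assms(1) xA by (fastforce simp: C_def full_shift_def split: if_splits)
  qed
  ultimately show ?thesis by (auto simp: shift_topology_def openin_subtopology)
qed

lemma continuous_map_sliding_block:
  assumes X: "X \<subseteq> full_shift A" and Y: "Y \<subseteq> full_shift B"
    and maps: "\<And>x. x \<in> X \<Longrightarrow> (\<lambda>n. f (window x n m)) \<in> Y"
  shows "continuous_map (shift_topology A X) (shift_topology B Y) (\<lambda>x n. f (window x n m))"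
proof -
  have "continuous_map (shift_topology A X) (discrete_topology B) (\<lambda>x. f (window x n m))" for n
    unfolding continuous_map_def
  proof (intro conjI allI impI)
    show "(\<lambda>x. f (window x n m)) \<in> topspace (shift_topology A X) \<rightarrow> topspace (discrete_topology B)"
      using maps Y by (fastforce simp: topspace_shift_topology[OF X] full_shift_def)
    fix U
    show "openin (shift_topology A X) {x \<in> topspace (shift_topology A X). f (window x n m) \<in> U}"
      unfolding topspace_shift_topology[OF X]
    proof (subst openin_subopen, intro ballI)
      fix x assume "x \<in> {x \<in> X. f (window x n m) \<in> U}"
      then show "\<exists>T. openin (shift_topology A X) T \<and> x \<in> T \<and> T \<subseteq> {x \<in> X. f (window x n m) \<in> U}"
        using openin_cylinder[OF X, of x n m]
        by (intro exI[of _ "{y \<in> X. window y n m = window x n m}"]) auto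
    qed
  qed
  then show ?thesis
    using maps unfolding shift_topology_def[of B]
    by (auto simp: continuous_map_in_subtopology continuous_map_componentwise_UNIV
        topspace_shift_topology[OF X])
qed

section \<open>Transitive shifts of finite type are strongly connected vertex shifts\<close>

text \<open>The vertices are the admissible words of a length \<open>m\<close> that determines the shift, and an edge
  joins two words overlapping in \<open>m - 1\<close> letters. The conjugacy reads off the first letter of each
  block, and its inverse reads whole windows. Transitivity gives a point of the shift in which one
  given word occurs before another; its windows between the two occurrences form a walk.\<close>

theorem transitive_SFT_conjugate_vertex_shift:
  fixes A :: "'a set"
  assumes fin: "finite A" and sft: "shift_of_finite_type A X" and trans: "topologically_transitive X"
  shows "\<exists>(B :: nat set) R. finite B \<and> B \<noteq> {} \<and> strongly_connected B R \<and>
           topologically_conjugate B (vertex_shift B R) A X"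
proof -
  have X: "X \<subseteq> full_shift A" using sft by (rule shift_of_finite_type_subset)
  obtain m where m: "0 < m" and sft_win: "\<And>x. (\<And>i. window x i m \<in> language X) \<Longrightarrow> x \<in> X"
    using shift_of_finite_type_windows[OF sft] by blast
  define W where "W = {w \<in> language X. length w = m}"
  have win_W: "window x i m \<in> W" if "x \<in> X" for x i
    using that by (simp add: W_def window_in_language)
  have "W \<subseteq> {w. set w \<subseteq> A \<and> length w = m}"
    using X by (fastforce simp: W_def language_def subword_of_def full_shift_def in_set_conv_nth)
  then have "finite W" using finite_lists_length_eq[OF fin] finite_subset by blast
  then obtain code :: "'a list \<Rightarrow> nat" where inj: "inj_on code W"
    using finite_imp_inj_to_nat_seg by blast
  define decode where "decode = inv_into W code"
  have decode [simp]: "decode (code w) = w" if "w \<in> W" for w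
    using that inj by (simp add: decode_def)
  define B where "B = code ` W"
  define R where "R a b \<longleftrightarrow> tl (decode a) = butlast (decode b)" for a b
  let ?Y = "vertex_shift B R"
  define h where "h = (\<lambda>(y :: int \<Rightarrow> nat) n. hd (decode (y n)))"
  define g where "g = (\<lambda>x n. code (window x n m))"

  have g_walk: "g x \<in> ?Y" if "x \<in> X" for x
    using that by (auto simp: g_def vertex_shift_def B_def R_def win_W window_overlap)

  \<comment> \<open>Following the overlaps along \<open>y\<close>, each letter of a block is the first letter of a later
    block.\<close>
  have decode_y: "decode (y n) = window (h y) n m" if y: "y \<in> ?Y" for y n
  proof -
    have W: "decode (y n) \<in> W" for n
      using y by (auto simp: vertex_shift_def B_def decode_def intro: inv_into_into)
    then have len: "length (decode (y n)) = m" for n by (simp add: W_def)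
    have "decode (y n) ! j = h y (n + int j)" if "j < m" for j
      using that
    proof (induction j arbitrary: n)
      case 0
      then show ?case using len[of n] by (auto simp: h_def hd_conv_nth simp flip: length_greater_0_conv)
    next
      case (Suc j)
      have "decode (y n) ! Suc j = tl (decode (y n)) ! j"
        using Suc.prems len[of n] by (simp add: nth_tl)
      also have "\<dots> = butlast (decode (y (n + 1))) ! j"
        using y by (simp add: vertex_shift_def R_def)
      also have "\<dots> = h y (n + 1 + int j)"
        using Suc len[of "n + 1"] by (simp add: nth_butlast)
      finally show ?case by (simp add: ac_simps)
    qed
    then show ?thesis by (intro nth_equalityI) (auto simp: len)
  qed
  have y_W: "window (h y) n m \<in> W" if "y \<in> ?Y" for y n
    using that by (auto simp flip: decode_y
        simp: vertex_shift_def B_def decode_def intro: inv_into_into)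
  have h_X: "h y \<in> X" if "y \<in> ?Y" for y
    using y_W[OF that] by (intro sft_win) (simp add: W_def)
  have hg: "h (g x) = x" if "x \<in> X" for x
    using that m by (auto simp: h_def g_def win_W hd_window)
  have gh: "g (h y) = y" if y: "y \<in> ?Y" for y
  proof
    fix n
    have "y n \<in> B" using y by (auto simp: vertex_shift_def)
    then show "g (h y) n = y n"
      unfolding g_def decode_y[OF y, symmetric] by (auto simp: B_def)
  qed

  have Y: "?Y \<subseteq> full_shift B" by (auto simp: vertex_shift_def full_shift_def)
  have h_window: "h = (\<lambda>y n. hd (decode (hd (window y n 1))))"
    by (simp add: h_def hd_window)
  have "continuous_map (shift_topology B ?Y) (shift_topology A X) h"
    unfolding h_window
    by (rule continuous_map_sliding_block[OF Y X, of "\<lambda>w. hd (decode (hd w))"])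
      (use h_X in \<open>simp add: h_window\<close>)
  moreover have "continuous_map (shift_topology A X) (shift_topology B ?Y) g"
    using continuous_map_sliding_block[OF X Y, of code m] g_walk by (simp add: g_def)
  ultimately have "homeomorphic_maps (shift_topology B ?Y) (shift_topology A X) h g"
    by (simp add: homeomorphic_maps_def topspace_shift_topology X Y hg gh)
  then have "homeomorphic_map (shift_topology B ?Y) (shift_topology A X) h"
    using homeomorphic_map_maps by blast
  moreover have "h (shift_map y) = shift_map (h y)" for y by (simp add: h_def shift_map_def)
  ultimately have conj: "topologically_conjugate B ?Y A X"
    by (auto simp: topologically_conjugate_def)

  have "strongly_connected B R"
    unfolding strongly_connected_def
  proof (intro ballI)
    fix a b assume "a \<in> B" "b \<in> B"
    then obtain u v where u: "u \<in> W" "a = code u" and v: "v \<in> W" "b = code v"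
      by (auto simp: B_def)
    then obtain w where "u @ w @ v \<in> language X"
      using trans by (auto simp: topologically_transitive_def W_def)
    then obtain x i where x: "x \<in> X" "u @ w @ v = window x i (length (u @ w @ v))"
      by (auto simp: language_def subword_of_iff_window)
    define l where "l = length (u @ w)"
    have nth: "(u @ w @ v) ! j = x (i + int j)" if "j < length (u @ w @ v)" for j
      using that by (subst x(2)) (simp only: nth_window)
    have "u = window x i m"
    proof (rule nth_equalityI)
      fix j assume "j < length u"
      then show "u ! j = window x i m ! j"
        using u nth[of j] by (simp add: W_def nth_append)
    qed (use u in \<open>simp add: W_def\<close>)
    moreover have "v = window x (i + int l) m"
    proof (rule nth_equalityI)
      fix j assume "j < length v"
      then show "v ! j = window x (i + int l) m ! j"
        using v nth[of "l + j"] by (simp add: W_def l_def nth_append ac_simps)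
    qed (use v in \<open>simp add: W_def\<close>)
    ultimately have "a = g x i" "b = g x (i + int l)"
      using u v by (auto simp: g_def)
    moreover have "walk B R (window (g x) i (Suc l))"
      using g_walk[OF x(1)] subword_of_iff_window[of "window (g x) i (Suc l)" "g x"]
      by (auto simp: vertex_shift_iff_walks)
    ultimately have "walk_between B R a b (window (g x) i (Suc l))"
      by (auto simp: walk_between_def hd_window last_conv_nth simp flip: length_0_conv)
    then show "\<exists>w. walk_between B R a b w" by blast
  qed
  moreover have "finite B" "B \<noteq> {}"
    using \<open>finite W\<close> trans win_W by (auto simp: B_def topologically_transitive_def)
  ultimately show ?thesis using conj by blast
qed

section \<open>Transitive shifts of finite type are primitive RS-subshifts\<close>

theorem corollary23:
  fixes A :: "'a set" and X :: "(int \<Rightarrow> 'a) set"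
  assumes "finite A"
    and "shift_of_finite_type A X"
    and "topologically_transitive X"
  shows "\<exists>(B :: nat set) \<theta>. random_substitution B \<theta> \<and> primitive_subst B \<theta> \<and>
           topologically_conjugate B (RS_subshift B \<theta>) A X"
proof -
  obtain B :: "nat set" and R where "finite B" "B \<noteq> {}" "strongly_connected B R"
      and conj: "topologically_conjugate B (vertex_shift B R) A X"
    using transitive_SFT_conjugate_vertex_shift[OF assms] by blast
  then obtain \<theta> where "random_substitution B \<theta>" "primitive_subst B \<theta>"
      "RS_subshift B \<theta> = vertex_shift B R"
    using vertex_shift_is_RS_subshift by blast
  then show ?thesis using conj by metis
qed

end
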